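(* Let $\beta>0$, $\lambda\ge 0$ and $\Sigma=I+\beta x^*x^{*\top}\in\mathbb{R}^{d\times d}$, where $x^*\in\mathbb{S}^{d-1}$ is $s$-sparse with equal magnitudes: there is $\mathcal I\subset[d]$ with $|\mathcal I|=s$ such that $x^*_i\in\{-1/\sqrt s,1/\sqrt s\}$ for $i\in\mathcal I$ and $x^*_i=0$ otherwise. Let $f_\lambda(x)=-x^\top\Sigma x+\lambda\|x\|_1$. Suppose $2\beta>\lambda\sqrt s>0$, let $\bar\theta\in\big(0,\min\{\arccos(\lambda\sqrt s/(2\beta)),\pi/2\}\big)$, and let $$\mathcal S=\{x\in\mathbb{S}^{d-1}:\theta(x,x^* )\in(0,\bar\theta)\}.$$ Then $f_\lambda$ is $(\mu,2)$-RGA on $(\mathcal S,x^* )$ with $$\mu=\frac{2\beta\cos(\bar\theta)-\lambda\sqrt s}{\beta+\lambda\sqrt d}.$$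
   Context: $\mathbb{S}^{d-1}$ is the unit sphere of $\mathbb{R}^d$; $\theta(x,y)=\arccos(x\cdot y)$ for unit vectors; $[d]=\{1,\dots,d\}$. For a locally Lipschitz $f$, $\partial^Cf(x)$ is the Clarke subdifferential (convex hull of limits of gradients at differentiability points $y_k\to x$) and $\partial^{C,R}f(x)=\{(I-xx^\top)\xi:\xi\in\partial^Cf(x)\}$. $f$ is $(\mu,r)$-RGA at $(x,x^* )$ if every $g(x)\in\partial^{C,R}f(x)$ satisfies: $g(x)\neq0$ whenever $x\ne x^*$, and $g(x)\cdot x^*\le-\mu\,\sin^r(\theta(x,x^* ))\,\|g(x)\|_2$; it is $(\mu,r)$-RGA on $(\mathcal X,x^* )$ if this holds for every $x\in\mathcal X$. *)

theory Defs
  imports "HOL-Analysis.Analysis"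
begin

definition angle :: "real ^ 'n \<Rightarrow> real ^ 'n \<Rightarrow> real" where
  "angle x y = arccos (x \<bullet> y)"

definition outer :: "real ^ 'n \<Rightarrow> real ^ 'n \<Rightarrow> real ^ 'n ^ 'n" where
  "outer x y = (\<chi> i j. x $ i * y $ j)"

definition l1_norm :: "real ^ 'n \<Rightarrow> real" where
  "l1_norm x = (\<Sum>i\<in>UNIV. \<bar>x $ i\<bar>)"

definition clarke_subdiff :: "(real ^ 'n \<Rightarrow> real) \<Rightarrow> real ^ 'n \<Rightarrow> (real ^ 'n) set" where
  "clarke_subdiff f x = convex hull
     {\<xi>. \<exists>y g. y \<longlonglongrightarrow> x \<and> (\<forall>k. GDERIV f (y k) :> g k) \<and> g \<longlonglongrightarrow> \<xi>}"

definition riemannian_clarke_subdiff ::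
    "(real ^ 'n \<Rightarrow> real) \<Rightarrow> real ^ 'n \<Rightarrow> (real ^ 'n) set" where
  "riemannian_clarke_subdiff f x = (\<lambda>\<xi>. (mat 1 - outer x x) *v \<xi>) ` clarke_subdiff f x"

text \<open>The exponent \<open>r\<close> is real. Since \<open>0 powr r = 0\<close> for every \<open>r\<close>, this is the usual power of
  the (nonnegative) sine for \<open>r > 0\<close>, but not for \<open>r = 0\<close> when the sine vanishes.\<close>

definition RGA_at ::
    "real \<Rightarrow> real \<Rightarrow> (real ^ 'n \<Rightarrow> real) \<Rightarrow> real ^ 'n \<Rightarrow> real ^ 'n \<Rightarrow> bool" where
  "RGA_at \<mu> r f x xs \<longleftrightarrow>
     (\<forall>g \<in> riemannian_clarke_subdiff f x.
        (x \<noteq> xs \<longrightarrow> g \<noteq> 0) \<and> g \<bullet> xs \<le> - \<mu> * sin (angle x xs) powr r * norm g)"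

definition RGA_on ::
    "real \<Rightarrow> real \<Rightarrow> (real ^ 'n \<Rightarrow> real) \<Rightarrow> (real ^ 'n) set \<Rightarrow> real ^ 'n \<Rightarrow> bool" where
  "RGA_on \<mu> r f X xs \<longleftrightarrow> (\<forall>x \<in> X. RGA_at \<mu> r f x xs)"

definition equal_magnitude_sparse :: "nat \<Rightarrow> real ^ 'n \<Rightarrow> bool" where
  "equal_magnitude_sparse s x \<longleftrightarrow>
     (\<exists>I. card I = s \<and> (\<forall>i\<in>I. x $ i \<in> {- 1 / sqrt (real s), 1 / sqrt (real s)})
        \<and> (\<forall>i. i \<notin> I \<longrightarrow> x $ i = 0))"

definition spiked_cov :: "real \<Rightarrow> real ^ 'n \<Rightarrow> real ^ 'n ^ 'n" where
  "spiked_cov \<beta> xs = mat 1 + \<beta> *\<^sub>R outer xs xs"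

definition spca_obj :: "real \<Rightarrow> real \<Rightarrow> real ^ 'n \<Rightarrow> real ^ 'n \<Rightarrow> real" where
  "spca_obj \<beta> lam xs x = - (x \<bullet> (spiked_cov \<beta> xs *v x)) + lam * l1_norm x"

text \<open>The Clarke subdifferential is only meaningful for locally Lipschitz functions; the objective
  is one.\<close>

lemma spca_obj_locally_lipschitz:
  fixes xs x :: "real ^ 'n"
  shows "\<exists>u>0. \<exists>L. L-lipschitz_on (cball x u) (spca_obj \<beta> lam xs)"
proof -
  define A where "A = spiked_cov \<beta> xs"
  obtain K where K: "\<And>z. norm (A *v z) \<le> norm z * K" and K0: "K > 0"
    using bounded_linear.pos_bounded[OF matrix_vector_mul_bounded_linear[of A]] by blast
  define R where "R = norm x + 1"
  define L where "L = 2 * R * K + \<bar>lam\<bar> * real CARD('n)"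
  have R0: "R > 0" by (simp add: R_def add_nonneg_pos)
  have "L-lipschitz_on (cball x 1) (spca_obj \<beta> lam xs)"
  proof (rule lipschitz_onI)
    show "0 \<le> L" using R0 K0 by (simp add: L_def)
  next
    fix y z assume "y \<in> cball x 1" "z \<in> cball x 1"
    then have y: "norm y \<le> R" and z: "norm z \<le> R"
      unfolding R_def using norm_triangle_ineq2[of y x] norm_triangle_ineq2[of z x]
      by (auto simp: dist_norm norm_minus_commute)
    have "y \<bullet> (A *v y) - z \<bullet> (A *v z) = (y - z) \<bullet> (A *v y) + z \<bullet> (A *v (y - z))"
      by (simp add: inner_diff_left inner_diff_right matrix_vector_mult_diff_distrib)
    also have "\<bar>\<dots>\<bar> \<le> norm (y - z) * norm (A *v y) + norm z * norm (A *v (y - z))"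
      by (intro order.trans[OF abs_triangle_ineq] add_mono Cauchy_Schwarz_ineq2)
    also have "\<dots> \<le> norm (y - z) * (R * K) + R * (norm (y - z) * K)"
      using y z K0 R0
      by (intro add_mono mult_mono order.trans[OF K] mult_right_mono K) auto
    finally have q: "\<bar>y \<bullet> (A *v y) - z \<bullet> (A *v z)\<bar> \<le> 2 * R * K * norm (y - z)"
      by (simp add: algebra_simps)
    have "\<bar>l1_norm y - l1_norm z\<bar> \<le> (\<Sum>i\<in>UNIV. \<bar>\<bar>y $ i\<bar> - \<bar>z $ i\<bar>\<bar>)"
      unfolding l1_norm_def sum_subtractf[symmetric] by (rule sum_abs)
    also have "\<dots> \<le> (\<Sum>i\<in>(UNIV :: 'n set). norm (y - z))"
    proof (rule sum_mono)
      fix i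
      show "\<bar>\<bar>y $ i\<bar> - \<bar>z $ i\<bar>\<bar> \<le> norm (y - z)"
        using component_le_norm_cart[of "y - z" i] by simp
    qed
    finally have l: "\<bar>l1_norm y - l1_norm z\<bar> \<le> real CARD('n) * norm (y - z)" by simp
    have "\<bar>spca_obj \<beta> lam xs y - spca_obj \<beta> lam xs z\<bar>
        = \<bar>- (y \<bullet> (A *v y) - z \<bullet> (A *v z)) + lam * (l1_norm y - l1_norm z)\<bar>"
      by (simp add: spca_obj_def A_def algebra_simps)
    also have "\<dots> \<le> \<bar>y \<bullet> (A *v y) - z \<bullet> (A *v z)\<bar> + \<bar>lam\<bar> * \<bar>l1_norm y - l1_norm z\<bar>"
      by (metis abs_minus_cancel abs_mult abs_triangle_ineq)
    also have "\<dots> \<le> 2 * R * K * norm (y - z) + \<bar>lam\<bar> * (real CARD('n) * norm (y - z))"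
      by (intro add_mono q mult_left_mono l) auto
    finally show "dist (spca_obj \<beta> lam xs y) (spca_obj \<beta> lam xs z) \<le> L * dist y z"
      by (simp add: dist_norm L_def algebra_simps)
  qed
  then show ?thesis
    by (intro exI[of _ 1] conjI exI[of _ L]) auto
qed

end

theory Submission
  imports Defs
begin

text \<open>Write \<open>c = x \<bullet> xs = cos \<theta>\<close>. Apart from the \<open>\<ell>\<^sub>1\<close> term the objective is
  \<open>- x \<bullet> x - \<beta> c\<^sup>2\<close>, so every Clarke subgradient at \<open>x\<close> has the form
  \<open>\<xi> = - 2 x - 2 \<beta> c xs + \<lambda> v\<close>, where \<open>v \<bullet> x\<close> is the \<open>\<ell>\<^sub>1\<close> norm of \<open>x\<close> and all entries of \<open>v\<close>
  lie in \<open>[-1, 1]\<close> (lemma \<open>clarke_subdiff_spca\<close>). Projecting orthogonally to the unit vector \<open>x\<close>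
  gives \<open>g = - 2 \<beta> c (xs - c x) + \<lambda> (v - (v \<bullet> x) x)\<close>, and two estimates finish the proof.

  \<^item> Alignment: \<open>v \<bullet> xs\<close> is at most the \<open>\<ell>\<^sub>1\<close> norm of \<open>xs\<close>, which is \<open>\<surd>s\<close>, while \<open>v \<bullet> x\<close>, the
    \<open>\<ell>\<^sub>1\<close> norm of \<open>x\<close>, is at least \<open>c \<surd>s\<close> because the entries of \<open>xs\<close> are at most \<open>1 / \<surd>s\<close> in
    absolute value. Hence
    \<open>g \<bullet> xs \<le> - (2 \<beta> c - \<lambda> \<surd>s) (1 - c\<^sup>2)\<close>, and \<open>1 - c\<^sup>2 = sin\<^sup>2 \<theta>\<close>.
  \<^item> Size: \<open>xs - c x\<close> has norm \<open>sin \<theta>\<close> and \<open>2 sin \<theta> cos \<theta> \<le> 1\<close>, while projecting does not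
    increase the norm of \<open>v\<close>, which is at most \<open>\<surd>d\<close>. Hence \<open>norm g \<le> \<beta> + \<lambda> \<surd>d\<close>.

  As \<open>c > cos \<theta>b\<close> on the region considered, the first estimate is strictly negative, which also
  gives \<open>g \<noteq> 0\<close>.\<close>

section \<open>The subdifferential of the l1 norm\<close>

text \<open>The subdifferential of the \<open>\<ell>\<^sub>1\<close> norm at \<open>x\<close>, in its dual description: the vectors of the
  unit ball of the maximum norm that attain the \<open>\<ell>\<^sub>1\<close> norm of \<open>x\<close>. In this form it is visibly convex
  and stable under limits in \<open>x\<close>.\<close>

definition l1_subdiff :: "real ^ 'n \<Rightarrow> (real ^ 'n) set" where
  "l1_subdiff x = {v. v \<bullet> x = l1_norm x \<and> (\<forall>i. \<bar>v $ i\<bar> \<le> 1)}"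

lemma convex_l1_subdiff:
  fixes x :: "real ^ 'n"
  shows "convex (l1_subdiff x)"
proof (rule convexI)
  fix v w :: "real ^ 'n" and a b :: real
  assume v: "v \<in> l1_subdiff x" and w: "w \<in> l1_subdiff x"
    and ab: "0 \<le> a" "0 \<le> b" "a + b = 1"
  have "\<bar>(a *\<^sub>R v + b *\<^sub>R w) $ i\<bar> \<le> 1" for i
  proof -
    have "\<bar>(a *\<^sub>R v + b *\<^sub>R w) $ i\<bar> \<le> a * \<bar>v $ i\<bar> + b * \<bar>w $ i\<bar>"
      using ab abs_triangle_ineq[of "a * v $ i" "b * w $ i"] by (simp add: abs_mult)
    also have "\<dots> \<le> a * 1 + b * 1"
      using v w ab by (intro add_mono mult_left_mono) (auto simp: l1_subdiff_def)
    finally show ?thesis using ab by simp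
  qed
  moreover have "(a *\<^sub>R v + b *\<^sub>R w) \<bullet> x = (a + b) * l1_norm x"
    using v w by (simp add: l1_subdiff_def inner_add_left distrib_right)
  ultimately show "a *\<^sub>R v + b *\<^sub>R w \<in> l1_subdiff x"
    using ab by (simp add: l1_subdiff_def)
qed

lemma l1_norm_axis: "l1_norm (axis i (1::real)) = 1"
  by (simp add: l1_norm_def axis_def if_distrib[of abs] cong: if_cong)

lemma l1_norm_scaleR: "l1_norm (a *\<^sub>R x) = \<bar>a\<bar> * l1_norm x"
  by (simp add: l1_norm_def abs_mult sum_distrib_left)

lemma l1_norm_diff_le: "\<bar>l1_norm (x + h) - l1_norm x\<bar> \<le> l1_norm h"
proof -
  have "\<bar>l1_norm (x + h) - l1_norm x\<bar> \<le> (\<Sum>i\<in>UNIV. \<bar>\<bar>(x + h) $ i\<bar> - \<bar>x $ i\<bar>\<bar>)"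
    unfolding l1_norm_def sum_subtractf[symmetric] by (rule sum_abs)
  also have "\<dots> \<le> l1_norm h"
    unfolding l1_norm_def by (rule sum_mono) auto
  finally show ?thesis .
qed

lemma GDERIV_imp_directional_derivative:
  fixes u :: "'a::real_inner"
  assumes "GDERIV f y :> v"
  shows "((\<lambda>t. f (y + t *\<^sub>R u)) has_real_derivative (v \<bullet> u)) (at 0)"
proof -
  have f: "(f has_derivative (\<lambda>h. h \<bullet> v)) (at (y + 0 *\<^sub>R u))"
    using assms by (simp add: gderiv_def)
  have "((\<lambda>t. y + t *\<^sub>R u) has_derivative (\<lambda>t. t *\<^sub>R u)) (at 0)"
    by (auto intro!: derivative_eq_intros)
  from has_derivative_compose[OF this f]
  have "((\<lambda>t. f (y + t *\<^sub>R u)) has_derivative (\<lambda>t. t * (u \<bullet> v))) (at 0)"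
    by simp
  then show ?thesis
    unfolding has_field_derivative_def
    by (rule has_derivative_eq_rhs) (simp add: fun_eq_iff inner_commute)
qed

text \<open>Only directional derivatives are needed: no gradient of the \<open>\<ell>\<^sub>1\<close> norm is computed, and no
  description of its points of differentiability enters.\<close>

lemma GDERIV_l1_norm_imp_l1_subdiff:
  assumes "GDERIV l1_norm y :> v"
  shows "v \<in> l1_subdiff y"
proof -
  note dir = GDERIV_imp_directional_derivative[OF assms]
  \<comment> \<open>Along the ray through \<open>y\<close> the norm is linear, by homogeneity.\<close>
  have "((\<lambda>t. (1 + t) * l1_norm y) has_real_derivative l1_norm y) (at 0)"
    by (auto intro!: derivative_eq_intros)
  moreover have "\<forall>\<^sub>F t in nhds (0::real). l1_norm (y + t *\<^sub>R y) = (1 + t) * l1_norm y"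
  proof (rule eventually_nhds_in_open[THEN eventually_mono])
    show "open {-1<..<1::real}" "0 \<in> {-1<..<1::real}" by auto
  next
    fix t :: real assume "t \<in> {-1<..<1}"
    then show "l1_norm (y + t *\<^sub>R y) = (1 + t) * l1_norm y"
      using l1_norm_scaleR[of "1 + t" y] by (simp add: scaleR_left_distrib)
  qed
  ultimately have "((\<lambda>t. l1_norm (y + t *\<^sub>R y)) has_real_derivative l1_norm y) (at 0)"
    by (subst DERIV_cong_ev[OF refl _ refl])
  then have "v \<bullet> y = l1_norm y"
    using dir DERIV_unique by blast
  \<comment> \<open>Along a coordinate axis the norm is 1-Lipschitz.\<close>
  moreover have "\<bar>v $ i\<bar> \<le> 1" for i
  proof -
    have "((\<lambda>h. (l1_norm (y + h *\<^sub>R axis i 1) - l1_norm y) / h) \<longlongrightarrow> v $ i) (at 0)"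
      using dir[of "axis i 1"] by (simp add: DERIV_def inner_axis)
    from tendsto_rabs[OF this] show ?thesis
    proof (rule tendsto_upperbound)
      show "\<forall>\<^sub>F h in at 0. \<bar>(l1_norm (y + h *\<^sub>R axis i 1) - l1_norm y) / h\<bar> \<le> 1"
        using l1_norm_diff_le[of y "_ *\<^sub>R axis i 1"]
        by (intro always_eventually)
          (auto simp: l1_norm_scaleR l1_norm_axis divide_le_eq_1)
    qed simp
  qed
  ultimately show ?thesis by (simp add: l1_subdiff_def)
qed

section \<open>Clarke subgradients of the objective\<close>

lemma outer_mult: "outer a b *v z = (b \<bullet> z) *\<^sub>R a"
  by (simp add: outer_def vec_eq_iff matrix_vector_mult_def inner_vec_def sum_distrib_left mult_ac)

lemma spiked_cov_mult: "spiked_cov \<beta> xs *v x = x + (\<beta> * (xs \<bullet> x)) *\<^sub>R xs"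
  by (simp add: spiked_cov_def matrix_vector_mult_add_rdistrib outer_mult
      flip: scaleR_matrix_vector_assoc)

lemma spca_obj_eq:
  "spca_obj \<beta> lam xs x = - (x \<bullet> x) - \<beta> * (xs \<bullet> x)\<^sup>2 + lam * l1_norm x"
  by (simp add: spca_obj_def spiked_cov_mult inner_add_right power2_eq_square inner_commute)

text \<open>For \<open>lam \<noteq> 0\<close> the \<open>\<ell>\<^sub>1\<close> norm is the objective minus a smooth function, up to a factor, so it
  is differentiable wherever the objective is.\<close>

lemma GDERIV_spca_obj_imp_l1_subdiff:
  assumes "lam \<noteq> 0" and "GDERIV (spca_obj \<beta> lam xs) y :> g"
  shows "(g + 2 *\<^sub>R y + (2 * \<beta> * (xs \<bullet> y)) *\<^sub>R xs) /\<^sub>R lam \<in> l1_subdiff y"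
proof (rule GDERIV_l1_norm_imp_l1_subdiff)
  have "l1_norm = (\<lambda>z. (spca_obj \<beta> lam xs z + z \<bullet> z + \<beta> * (xs \<bullet> z)\<^sup>2) / lam)"
    using assms(1) by (simp add: spca_obj_eq fun_eq_iff)
  moreover have "GDERIV (\<lambda>z. (spca_obj \<beta> lam xs z + z \<bullet> z + \<beta> * (xs \<bullet> z)\<^sup>2) / lam) y :>
      (g + 2 *\<^sub>R y + (2 * \<beta> * (xs \<bullet> y)) *\<^sub>R xs) /\<^sub>R lam"
    unfolding gderiv_def
  proof (rule has_derivative_eq_rhs)
    have "(spca_obj \<beta> lam xs has_derivative (\<lambda>h. h \<bullet> g)) (at y)"
      using assms(2) by (simp add: gderiv_def)
    then show "((\<lambda>z. (spca_obj \<beta> lam xs z + z \<bullet> z + \<beta> * (xs \<bullet> z)\<^sup>2) / lam) has_derivative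
        (\<lambda>h. (h \<bullet> g + (y \<bullet> h + h \<bullet> y) + \<beta> * (2 * (xs \<bullet> h) * (xs \<bullet> y))) / lam)) (at y)"
      using assms(1) by (auto intro!: derivative_eq_intros simp: mult_ac)
  qed (simp add: fun_eq_iff inner_add_right inner_commute divide_inverse algebra_simps)
  ultimately show "GDERIV l1_norm y :> (g + 2 *\<^sub>R y + (2 * \<beta> * (xs \<bullet> y)) *\<^sub>R xs) /\<^sub>R lam"
    by simp
qed

text \<open>The set of vectors of the stated form is convex, so it contains the Clarke subdifferential as
  soon as it contains every limit of gradients; for these, both conditions that define
  \<open>l1_subdiff\<close> pass to the limit.\<close>

lemma clarke_subdiff_spca:
  assumes "lam \<noteq> 0" and "\<xi> \<in> clarke_subdiff (spca_obj \<beta> lam xs) x"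
  obtains v where "v \<in> l1_subdiff x"
    and "\<xi> = lam *\<^sub>R v - 2 *\<^sub>R x - (2 * \<beta> * (xs \<bullet> x)) *\<^sub>R xs"
proof -
  define w where "w y = 2 *\<^sub>R y + (2 * \<beta> * (xs \<bullet> y)) *\<^sub>R xs" for y
  define K where "K = (\<lambda>v. - w x + lam *\<^sub>R v) ` l1_subdiff x"
  have "clarke_subdiff (spca_obj \<beta> lam xs) x \<subseteq> K"
    unfolding clarke_subdiff_def
  proof (rule hull_minimal)
    show "convex K"
      unfolding K_def by (intro convex_affinity convex_l1_subdiff)
    show "{\<xi>. \<exists>y g. y \<longlonglongrightarrow> x \<and> (\<forall>k. GDERIV (spca_obj \<beta> lam xs) (y k) :> g k) \<and> g \<longlonglongrightarrow> \<xi>} \<subseteq> K"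
    proof safe
      fix \<eta> y g
      assume y: "y \<longlonglongrightarrow> x" and g: "g \<longlonglongrightarrow> \<eta>"
        and D: "\<forall>k. GDERIV (spca_obj \<beta> lam xs) (y k) :> g k"
      define v where "v k = (g k + w (y k)) /\<^sub>R lam" for k
      have v: "v k \<in> l1_subdiff (y k)" for k
        using GDERIV_spca_obj_imp_l1_subdiff[OF assms(1) D[rule_format, of k]]
        by (simp add: v_def w_def add.assoc)
      define u where "u = (\<eta> + w x) /\<^sub>R lam"
      have lim: "v \<longlonglongrightarrow> u"
        unfolding v_def u_def w_def by (intro tendsto_intros y g)
      have "(\<lambda>k. v k \<bullet> y k) \<longlonglongrightarrow> u \<bullet> x"
        by (intro tendsto_intros lim y)
      moreover have "(\<lambda>k. v k \<bullet> y k) \<longlonglongrightarrow> l1_norm x"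
      proof -
        have "(\<lambda>k. l1_norm (y k)) \<longlonglongrightarrow> l1_norm x"
          unfolding l1_norm_def by (intro tendsto_intros y)
        then show ?thesis using v by (simp add: l1_subdiff_def)
      qed
      ultimately have "u \<bullet> x = l1_norm x"
        by (rule LIMSEQ_unique)
      moreover have "\<bar>u $ i\<bar> \<le> 1" for i
      proof (rule LIMSEQ_le_const2)
        show "(\<lambda>k. \<bar>v k $ i\<bar>) \<longlonglongrightarrow> \<bar>u $ i\<bar>"
          by (intro tendsto_intros lim)
      qed (use v in \<open>auto simp: l1_subdiff_def\<close>)
      ultimately have "u \<in> l1_subdiff x" by (simp add: l1_subdiff_def)
      moreover have "\<eta> = - w x + lam *\<^sub>R u"
        using assms(1) by (simp add: u_def)
      ultimately show "\<eta> \<in> K" unfolding K_def by blast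
    qed
  qed
  with assms(2) obtain v where "v \<in> l1_subdiff x" "\<xi> = - w x + lam *\<^sub>R v"
    unfolding K_def by blast
  then show thesis
    by (intro that[of v]) (simp_all add: w_def algebra_simps)
qed

section \<open>Estimates for the alignment and the size\<close>

lemma norm_l1_subdiff_le:
  fixes v :: "real ^ 'n"
  assumes "v \<in> l1_subdiff x"
  shows "norm v \<le> sqrt (real CARD('n))"
proof -
  have "(\<Sum>i\<in>UNIV. (v $ i)\<^sup>2) \<le> (\<Sum>i\<in>(UNIV::'n set). 1)"
    using assms by (intro sum_mono) (simp add: l1_subdiff_def abs_square_le_1)
  then show ?thesis
    by (simp add: norm_vec_def L2_set_def)
qed

lemma inner_l1_subdiff_le:
  assumes "v \<in> l1_subdiff x"
  shows "v \<bullet> z \<le> l1_norm z"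
  unfolding inner_vec_def l1_norm_def
proof (rule sum_mono)
  fix i
  have "\<bar>v $ i\<bar> * \<bar>z $ i\<bar> \<le> 1 * \<bar>z $ i\<bar>"
    using assms by (intro mult_right_mono) (auto simp: l1_subdiff_def)
  then show "v $ i \<bullet> z $ i \<le> \<bar>z $ i\<bar>"
    using abs_ge_self[of "v $ i * z $ i"] by (simp add: abs_mult)
qed

lemma equal_magnitude_sparse_l1_norm:
  assumes "equal_magnitude_sparse s xs"
  shows "l1_norm xs = sqrt (real s)"
proof -
  obtain I where I: "card I = s" "\<And>i. i \<in> I \<Longrightarrow> \<bar>xs $ i\<bar> = 1 / sqrt (real s)"
    "\<And>i. i \<notin> I \<Longrightarrow> xs $ i = 0"
    using assms unfolding equal_magnitude_sparse_def by fastforce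
  have "l1_norm xs = (\<Sum>i\<in>I. \<bar>xs $ i\<bar>)"
    unfolding l1_norm_def using I(3) by (intro sum.mono_neutral_right) auto
  also have "\<dots> = real s / sqrt (real s)"
    using I by simp
  finally show ?thesis by (simp add: real_div_sqrt)
qed

text \<open>Hoelder's inequality, as the largest entry of \<open>xs\<close> in absolute value is \<open>1 / \<surd>s\<close>.\<close>

lemma equal_magnitude_sparse_inner_le:
  assumes "equal_magnitude_sparse s xs"
  shows "sqrt (real s) * (x \<bullet> xs) \<le> l1_norm x"
proof -
  have "sqrt (real s) * \<bar>xs $ i\<bar> \<le> 1" for i
  proof -
    have "\<bar>xs $ i\<bar> = 1 / sqrt (real s) \<or> xs $ i = 0"
      using assms unfolding equal_magnitude_sparse_def by force
    then show ?thesis by auto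
  qed
  then have "\<bar>x $ i\<bar> * (sqrt (real s) * \<bar>xs $ i\<bar>) \<le> \<bar>x $ i\<bar> * 1" for i
    by (intro mult_left_mono) auto
  moreover have "sqrt (real s) * (x $ i * xs $ i) \<le> \<bar>x $ i\<bar> * (sqrt (real s) * \<bar>xs $ i\<bar>)" for i
    using abs_ge_self[of "sqrt (real s) * (x $ i * xs $ i)"] by (simp add: abs_mult mult_ac)
  ultimately have "sqrt (real s) * (x $ i * xs $ i) \<le> \<bar>x $ i\<bar>" for i
    by (simp only: mult_1_right) (rule order.trans)
  then show ?thesis
    unfolding inner_vec_def l1_norm_def sum_distrib_left inner_real_def by (rule sum_mono)
qed

lemma projection_mult: "(mat 1 - outer x x) *v z = z - (z \<bullet> x) *\<^sub>R x"
  by (simp add: matrix_vector_mult_diff_rdistrib outer_mult inner_commute)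

lemma power2_norm_projection:
  assumes "norm x = 1"
  shows "(norm (z - (z \<bullet> x) *\<^sub>R x))\<^sup>2 = (norm z)\<^sup>2 - (z \<bullet> x)\<^sup>2"
  using assms unfolding power2_norm_eq_inner norm_eq_1
  by (simp add: inner_diff_left inner_diff_right power2_eq_square inner_commute[of x z])

lemma norm_projection_le:
  assumes "norm x = 1"
  shows "norm (z - (z \<bullet> x) *\<^sub>R x) \<le> norm z"
  using power2_norm_projection[OF assms, of z] by (auto intro: power2_le_imp_le)

section \<open>Riemannian gradient alignment\<close>

theorem theorem5p19:
  fixes \<beta> lam \<theta>b :: real and s :: nat and xs :: "real ^ 'd" and S :: "(real ^ 'd) set"
  assumes "\<beta> > 0" and "lam \<ge> 0"
    and "xs \<in> sphere 0 1"
    and "equal_magnitude_sparse s xs"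
    and "2 * \<beta> > lam * sqrt (real s)" and "lam * sqrt (real s) > 0"
    and "\<theta>b \<in> {0 <..< min (arccos (lam * sqrt (real s) / (2 * \<beta>))) (pi / 2)}"
    and "S = {x \<in> sphere 0 1. angle x xs \<in> {0 <..< \<theta>b}}"
  shows "RGA_on ((2 * \<beta> * cos \<theta>b - lam * sqrt (real s)) / (\<beta> + lam * sqrt (real CARD('d)))) 2
           (spca_obj \<beta> lam xs) S xs"
proof -
  define m where "m = 2 * \<beta> * cos \<theta>b - lam * sqrt (real s)"
  define N where "N = \<beta> + lam * sqrt (real CARD('d))"
  have lam: "lam > 0" using assms(2,6) by (cases "lam = 0") auto
  have N: "N > 0" using assms(1) lam by (simp add: N_def add_pos_nonneg)
  have xs: "norm xs = 1" using assms(3) by simp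
  define q where "q = lam * sqrt (real s) / (2 * \<beta>)"
  have q: "0 < q" "q < 1" using assms(1,5,6) by (auto simp: q_def)
  \<comment> \<open>The bound \<open>\<theta>b < arccos q\<close> is exactly what makes the constant positive.\<close>
  have "cos \<theta>b > cos (arccos q)"
    using assms(7) q by (intro cos_monotone_0_pi arccos_ubound) (auto simp: q_def)
  then have "q < cos \<theta>b" using q by simp
  then have m: "m > 0" using assms(1) by (simp add: m_def q_def field_simps)
  have "(x \<noteq> xs \<longrightarrow> g \<noteq> 0) \<and> g \<bullet> xs \<le> - (m / N) * sin (angle x xs) powr 2 * norm g"
    if x_S: "x \<in> S" and g_sub: "g \<in> riemannian_clarke_subdiff (spca_obj \<beta> lam xs) x" for x g
  proof -
    define c where "c = x \<bullet> xs"
    define \<theta> where "\<theta> = angle x xs"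
    have x: "norm x = 1" and \<theta>: "0 < \<theta>" "\<theta> < \<theta>b" "\<theta>b < pi / 2"
      using x_S assms(7,8) by (auto simp: \<theta>_def)
    have "\<bar>c\<bar> \<le> 1"
      using Cauchy_Schwarz_ineq2[of x xs] x xs by (simp add: c_def)
    then have c: "cos \<theta> = c" by (simp add: \<theta>_def angle_def c_def cos_arccos_abs)
    have c_gt: "cos \<theta>b < c"
      using \<theta> pi_gt_zero unfolding c[symmetric] by (intro cos_monotone_0_pi) auto
    have c_pos: "c > 0"
      using \<theta> unfolding c[symmetric] by (intro cos_gt_zero) auto
    have sin_pos: "sin \<theta> > 0"
      using \<theta> pi_gt_zero by (intro sin_gt_zero) auto
    have sin2: "(sin \<theta>)\<^sup>2 = 1 - c\<^sup>2" by (simp add: sin_squared_eq c)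
    obtain \<xi> where \<xi>: "\<xi> \<in> clarke_subdiff (spca_obj \<beta> lam xs) x" "g = \<xi> - (\<xi> \<bullet> x) *\<^sub>R x"
      using g_sub unfolding riemannian_clarke_subdiff_def projection_mult by blast
    obtain v where v: "v \<in> l1_subdiff x"
      and \<xi>_eq: "\<xi> = lam *\<^sub>R v - 2 *\<^sub>R x - (2 * \<beta> * c) *\<^sub>R xs"
      using clarke_subdiff_spca[OF _ \<xi>(1)] lam by (metis c_def inner_commute less_irrefl)
    have xx: "x \<bullet> x = 1" "xs \<bullet> xs = 1" "xs \<bullet> x = c"
      using x xs by (simp_all add: norm_eq_1 c_def inner_commute)
    have g: "g = lam *\<^sub>R (v - (v \<bullet> x) *\<^sub>R x) - (2 * \<beta> * c) *\<^sub>R (xs - (xs \<bullet> x) *\<^sub>R x)"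
      unfolding \<xi>(2) \<xi>_eq by (simp add: inner_diff_left xx algebra_simps)
    have vx: "v \<bullet> x = l1_norm x" using v by (simp add: l1_subdiff_def)
    \<comment> \<open>Alignment; the bound on \<open>v \<bullet> x\<close> has the right direction since \<open>c > 0\<close>.\<close>
    have "g \<bullet> xs = lam * (v \<bullet> xs - l1_norm x * c) - 2 * \<beta> * c * (1 - c\<^sup>2)"
      unfolding g by (simp add: inner_diff_left vx xx c_def[symmetric] power2_eq_square)
    also have "v \<bullet> xs - l1_norm x * c \<le> sqrt (real s) - (sqrt (real s) * c) * c"
      using inner_l1_subdiff_le[OF v, of xs] equal_magnitude_sparse_l1_norm[OF assms(4)]
        equal_magnitude_sparse_inner_le[OF assms(4), of x] c_pos
      by (intro diff_mono mult_right_mono) (auto simp: c_def)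
    finally have "g \<bullet> xs \<le> lam * (sqrt (real s) - (sqrt (real s) * c) * c)
        - 2 * \<beta> * c * (1 - c\<^sup>2)"
      using lam by simp
    also have "\<dots> = - ((2 * \<beta> * c - lam * sqrt (real s)) * (sin \<theta>)\<^sup>2)"
      unfolding sin2 by (simp add: power2_eq_square algebra_simps)
    also have "\<dots> \<le> - (m * (sin \<theta>)\<^sup>2)"
      using c_gt assms(1) by (simp add: m_def mult_right_mono)
    finally have align: "g \<bullet> xs \<le> - (m * (sin \<theta>)\<^sup>2)" .
    \<comment> \<open>Size of the two tangential parts of \<open>g\<close>.\<close>
    have norm_t: "norm (xs - (xs \<bullet> x) *\<^sub>R x) = sin \<theta>"
    proof (rule power2_eq_imp_eq)
      show "(norm (xs - (xs \<bullet> x) *\<^sub>R x))\<^sup>2 = (sin \<theta>)\<^sup>2"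
        using power2_norm_projection[OF x, of xs] by (simp add: xs xx(3) sin2)
    qed (use sin_pos in auto)
    \<comment> \<open>The left-hand side is \<open>sin (2 \<theta>)\<close>.\<close>
    have "2 * c * sin \<theta> \<le> 1"
      using sin_le_one[of "2 * \<theta>"] unfolding sin_double c by (simp only: mult_ac)
    then have "\<beta> * (2 * c * sin \<theta>) \<le> \<beta> * 1"
      using assms(1) by (intro mult_left_mono) auto
    then have t: "2 * \<beta> * c * sin \<theta> \<le> \<beta>" by (simp add: mult_ac)
    have "norm g \<le> lam * norm (v - (v \<bullet> x) *\<^sub>R x) + 2 * \<beta> * c * norm (xs - (xs \<bullet> x) *\<^sub>R x)"
      unfolding g using lam assms(1) c_pos
      by (intro order.trans[OF norm_triangle_ineq4]) simp
    also have "\<dots> \<le> lam * sqrt (real CARD('d)) + \<beta>"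
      using lam t unfolding norm_t
      by (intro add_mono mult_left_mono order.trans[OF norm_projection_le[OF x]]
          norm_l1_subdiff_le[OF v]) auto
    finally have "norm g \<le> N" by (simp add: N_def)
    then have "m / N * (sin \<theta>)\<^sup>2 * norm g \<le> m / N * (sin \<theta>)\<^sup>2 * N"
      using m N by (intro mult_left_mono) auto
    also have "\<dots> = m * (sin \<theta>)\<^sup>2" using N by simp
    finally have "g \<bullet> xs \<le> - (m / N) * (sin \<theta>)\<^sup>2 * norm g"
      using align by simp
    moreover have "m * (sin \<theta>)\<^sup>2 > 0"
      using m sin_pos by simp
    then have "g \<noteq> 0" using align by auto
    ultimately show ?thesis
      using sin_pos by (simp add: \<theta>_def[symmetric])
  qed
  then show ?thesis
    by (simp add: RGA_on_def RGA_at_def m_def N_def)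
qed

end
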